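(* Let $Y$ be a subspace of a locally convex space $(X,\tau)$ where $\tau$ is induced by a directed family $\mathcal{P}$ of seminorms. Consider the following statements. (a) $Y$ has the property-SNP in $X$. (b) Every member of $X^*$ can be expressed as a unique sum of members of $Y_{lcs}^\#$ and $Y^\perp$ (i.e. for every $f\in X^*$ there is exactly one pair $(g,h)\in Y_{lcs}^\#\times Y^\perp$ with $f=g+h$). (c) If $f_1,f_2\in Y_{lcs}^\#$ are such that $f_1+f_2\in Y^\perp$, then $f_1+f_2=0$. Then (a) $\Rightarrow$ (b) $\Rightarrow$ (c).
   Context: Scalars are real. For seminorms, $\rho\succeq\mu$ means $\rho(x)\ge\mu(x)$ for all $x$. $\mathcal{P}$ is directed if for all $\rho_1,\rho_2\in\mathcal{P}$ there is $\rho_3\in\mathcal{P}$ with $\rho_3\succeq\max\{\rho_1,\rho_2\}$. $X^*$ is the continuous dual of $X$, $Y^*$ the dual of $Y$ with the subspace topology, $Y^\perp=\{g\in X^*:g|_Y=0\}$. For $\rho\in\mathcal{P}$, $f\in X^*$, $h\in Y^*$: $\chi_\rho^X(f)=\sup\{|f(x)|:x\in X,\rho(x)\le1\}\in[0,\infty]$, $\chi_\rho^Y(h)=\sup\{|h(y)|:y\in Y,\rho(y)\le1\}\in[0,\infty]$. For $\mu\in\mathcal{P}$, $\mathcal{P}_\mu=\{\rho\in\mathcal{P}:\rho\succeq\mu\}$. $Y_\mu^\#=\{f\in X^*:\chi_\rho^X(f)=\chi_\rho^Y(f|_Y)<\infty\text{ for all }\rho\in\mathcal{P}_\mu\}$ and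 $Y_{lcs}^\#=\bigcup_{\mu\in\mathcal{P}}Y_\mu^\#$. For $h\in Y^*$ and $\rho\in\mathcal{P}$ with $\chi_\rho^Y(h)<\infty$, a Hahn-Banach extension (HBE) of the pair $(h,\rho)$ is an $\widetilde h\in X^*$ with $\widetilde h|_Y=h$ and $\chi_\rho^X(\widetilde h)=\chi_\rho^Y(h)$. $Y$ has property-SNP in $X$ if for every $h\in Y^*$ there are $\mu\in\mathcal{P}$ with $\chi_\mu^Y(h)<\infty$ and $\widetilde h\in X^*$ such that for every $\rho\in\mathcal{P}_\mu$, $\widetilde h$ is the unique HBE of $(h,\rho)$ (the same $\widetilde h$ for all these $\rho$). *)

theory Defs
  imports "HOL-Analysis.Analysis"
begin

definition seminorm :: "('a::real_vector \<Rightarrow> real) \<Rightarrow> bool" where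
  "seminorm \<rho> \<longleftrightarrow>
     (\<forall>x y. \<rho> (x + y) \<le> \<rho> x + \<rho> y) \<and> (\<forall>c x. \<rho> (c *\<^sub>R x) = \<bar>c\<bar> * \<rho> x)"

(* The order \<rho> \<succeq> \<mu> on seminorms is the library's pointwise order \<mu> \<le> \<rho> on functions. *)

definition directed_family :: "('a \<Rightarrow> real) set \<Rightarrow> bool" where
  "directed_family P \<longleftrightarrow>
     (\<forall>\<rho>1\<in>P. \<forall>\<rho>2\<in>P. \<exists>\<rho>3\<in>P. (\<lambda>x. max (\<rho>1 x) (\<rho>2 x)) \<le> \<rho>3)"

(* The open seminorm balls form a subbasis. UNIV only matters for P = {}: it makes the whole
   space the underlying set of the topology in that case too. *)
definition seminorm_topology :: "('a::real_vector \<Rightarrow> real) set \<Rightarrow> 'a topology" where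
  "seminorm_topology P =
     topology_generated_by (insert UNIV {{y. \<rho> (y - x) < e} |\<rho> x e. \<rho> \<in> P \<and> e > 0})"

definition dual :: "'a::real_vector topology \<Rightarrow> ('a \<Rightarrow> real) set" where
  "dual \<tau> = {f. linear f \<and> continuous_map \<tau> euclideanreal f}"

(* A functional on the subspace Y is represented by a function on the whole type that is
   undefined outside Y (membership in extensional Y), so that equality of representatives is
   equality on Y. Accordingly f|Y is the library's restrict f Y. *)
definition subspace_dual :: "'a::real_vector topology \<Rightarrow> 'a set \<Rightarrow> ('a \<Rightarrow> real) set" where
  "subspace_dual \<tau> Y =
     {h \<in> extensional Y.
        (\<forall>x\<in>Y. \<forall>y\<in>Y. h (x + y) = h x + h y) \<and>
        (\<forall>c. \<forall>x\<in>Y. h (c *\<^sub>R x) = c * h x) \<and>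
        continuous_map (subtopology \<tau> Y) euclideanreal h}"

definition annihilator :: "'a::real_vector topology \<Rightarrow> 'a set \<Rightarrow> ('a \<Rightarrow> real) set" where
  "annihilator \<tau> Y = {g \<in> dual \<tau>. \<forall>y\<in>Y. g y = 0}"

(* chi \<rho> UNIV f and chi \<rho> Y h are the two extended-valued quantities for f in the dual of
   the whole space and h in the dual of Y. *)
definition chi :: "('a \<Rightarrow> real) \<Rightarrow> 'a set \<Rightarrow> ('a \<Rightarrow> real) \<Rightarrow> ennreal" where
  "chi \<rho> S f = (SUP x\<in>{x \<in> S. \<rho> x \<le> 1}. ennreal \<bar>f x\<bar>)"

definition above :: "('a \<Rightarrow> real) set \<Rightarrow> ('a \<Rightarrow> real) \<Rightarrow> ('a \<Rightarrow> real) set" where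
  "above P \<mu> = {\<rho> \<in> P. \<mu> \<le> \<rho>}"

definition sharp_at ::
  "'a::real_vector topology \<Rightarrow> ('a \<Rightarrow> real) set \<Rightarrow> 'a set \<Rightarrow> ('a \<Rightarrow> real) \<Rightarrow> ('a \<Rightarrow> real) set" where
  "sharp_at \<tau> P Y \<mu> =
     {f \<in> dual \<tau>. \<forall>\<rho> \<in> above P \<mu>.
        chi \<rho> UNIV f = chi \<rho> Y (restrict f Y) \<and> chi \<rho> Y (restrict f Y) < \<infinity>}"

definition sharp_lcs ::
  "'a::real_vector topology \<Rightarrow> ('a \<Rightarrow> real) set \<Rightarrow> 'a set \<Rightarrow> ('a \<Rightarrow> real) set" where
  "sharp_lcs \<tau> P Y = (\<Union>\<mu>\<in>P. sharp_at \<tau> P Y \<mu>)"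

definition is_HBE ::
  "'a::real_vector topology \<Rightarrow> 'a set \<Rightarrow> ('a \<Rightarrow> real) \<Rightarrow> ('a \<Rightarrow> real) \<Rightarrow> ('a \<Rightarrow> real) \<Rightarrow> bool" where
  "is_HBE \<tau> Y h \<rho> g \<longleftrightarrow>
     chi \<rho> Y h < \<infinity> \<and> g \<in> dual \<tau> \<and> restrict g Y = h \<and> chi \<rho> UNIV g = chi \<rho> Y h"

definition property_SNP ::
  "'a::real_vector topology \<Rightarrow> ('a \<Rightarrow> real) set \<Rightarrow> 'a set \<Rightarrow> bool" where
  "property_SNP \<tau> P Y \<longleftrightarrow>
     (\<forall>h \<in> subspace_dual \<tau> Y. \<exists>\<mu>\<in>P. chi \<mu> Y h < \<infinity> \<and>
        (\<exists>g \<in> dual \<tau>. \<forall>\<rho> \<in> above P \<mu>.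
           is_HBE \<tau> Y h \<rho> g \<and> (\<forall>g'. is_HBE \<tau> Y h \<rho> g' \<longrightarrow> g' = g)))"

end

theory Submission
  imports Defs
begin

text \<open>In a decomposition f = g + h with g sharp and h in the annihilator, h is forced to be f
  - g, so (b) says that each f agrees on Y with exactly one sharp g
  (\<open>sharp_decomposition_iff\<close>). A sharp functional is one that is, from some seminorm
  on, a Hahn-Banach extension of its own restriction. SNP, applied to the restriction of f,
  therefore supplies such a g, and directedness carries its uniqueness over to the whole union
  \<open>sharp_lcs\<close> (\<open>property_SNP_unique_sharp\<close>). For (c), sharpness survives a
  change of sign, so f1 = f1 + 0 = (-f2) + (f1 + f2) gives two decompositions of f1, which (b)
  forces to coincide.\<close>

lemma dual_zero: "(\<lambda>x. 0) \<in> dual \<tau>"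
  by (simp add: dual_def linear_iff)

lemma dual_uminus: "f \<in> dual \<tau> \<Longrightarrow> (\<lambda>x. - f x) \<in> dual \<tau>"
  by (simp add: dual_def linear_compose_neg continuous_map_minus)

lemma dual_diff: "f \<in> dual \<tau> \<Longrightarrow> g \<in> dual \<tau> \<Longrightarrow> (\<lambda>x. f x - g x) \<in> dual \<tau>"
  by (simp add: dual_def linear_compose_sub continuous_map_diff)

text \<open>Allows SNP, which speaks of functionals on Y, to be applied to the restriction of a
  given f.\<close>

lemma restrict_in_subspace_dual:
  assumes "f \<in> dual \<tau>" and "subspace Y"
  shows "restrict f Y \<in> subspace_dual \<tau> Y"
proof -
  have lin: "linear f" and cont: "continuous_map \<tau> euclideanreal f"
    using assms(1) by (auto simp: dual_def)
  have "continuous_map (subtopology \<tau> Y) euclideanreal (restrict f Y)"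
    by (rule continuous_map_eq[OF continuous_map_from_subtopology[OF cont]]) simp
  then show ?thesis
    using assms(2) by (simp add: subspace_dual_def subspace_add subspace_scale
        linear_add[OF lin] linear_scale[OF lin])
qed

lemma chi_uminus: "chi \<rho> S (\<lambda>x. - f x) = chi \<rho> S f"
  by (simp add: chi_def)

lemma chi_restrict: "chi \<rho> Y (restrict f Y) = chi \<rho> Y f"
  unfolding chi_def by (rule SUP_cong) auto

text \<open>\<open>chi\<close> sees only absolute values, so the same seminorm witnesses sharpness
  of f and of -f.\<close>

lemma sharp_lcs_uminus:
  assumes "f \<in> sharp_lcs \<tau> P Y"
  shows "(\<lambda>x. - f x) \<in> sharp_lcs \<tau> P Y"
  using assms by (auto simp: sharp_lcs_def sharp_at_def chi_restrict chi_uminus dual_uminus)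

lemma sharp_lcs_subset_dual: "sharp_lcs \<tau> P Y \<subseteq> dual \<tau>"
  by (auto simp: sharp_lcs_def sharp_at_def)

lemma directed_family_above:
  assumes "directed_family P" "\<mu> \<in> P" "\<nu> \<in> P"
  obtains \<rho> where "\<rho> \<in> above P \<mu>" "\<rho> \<in> above P \<nu>"
proof -
  obtain \<rho> where "\<rho> \<in> P" "(\<lambda>x. max (\<mu> x) (\<nu> x)) \<le> \<rho>"
    using assms unfolding directed_family_def by blast
  then have "\<rho> \<in> above P \<mu>" "\<rho> \<in> above P \<nu>"
    by (auto simp: above_def le_fun_def)
  then show thesis by (rule that)
qed

text \<open>Translates sharpness into the vocabulary of SNP: the condition that a functional extend
  its restriction holds trivially, and what remains of \<open>is_HBE\<close> is the finiteness and
  equality of the \<open>chi\<close> values.\<close>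

lemma sharp_at_iff_HBE:
  "f \<in> sharp_at \<tau> P Y \<mu> \<longleftrightarrow>
     f \<in> dual \<tau> \<and> (\<forall>\<rho> \<in> above P \<mu>. is_HBE \<tau> Y (restrict f Y) \<rho> f)"
  by (auto simp: sharp_at_def is_HBE_def)

text \<open>Two members of the union may be sharp from different seminorms on; directedness supplies
  a common seminorm above both, where uniqueness of the extension applies.\<close>
lemma property_SNP_unique_sharp:
  assumes "directed_family P" "subspace Y" "property_SNP \<tau> P Y" "f \<in> dual \<tau>"
  shows "\<exists>!g. g \<in> sharp_lcs \<tau> P Y \<and> restrict g Y = restrict f Y"
proof -
  let ?h = "restrict f Y"
  obtain \<mu> g where \<mu>: "\<mu> \<in> P" and g: "g \<in> dual \<tau>"
    and HBE: "\<And>\<rho>. \<rho> \<in> above P \<mu> \<Longrightarrow> is_HBE \<tau> Y ?h \<rho> g"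
    and unique: "\<And>\<rho> g'. \<rho> \<in> above P \<mu> \<Longrightarrow> is_HBE \<tau> Y ?h \<rho> g' \<Longrightarrow> g' = g"
    using assms(3) restrict_in_subspace_dual[OF assms(4,2)] unfolding property_SNP_def by metis
  \<comment> \<open>That g extends the restriction of f is part of \<open>is_HBE\<close>, so some
    member of \<open>above P \<mu>\<close> is required to extract it.\<close>
  have "\<mu> \<in> above P \<mu>"
    using \<mu> by (simp add: above_def)
  then have gh: "restrict g Y = ?h"
    using HBE by (auto simp: is_HBE_def)
  show ?thesis
  proof (rule ex1I[of _ g])
    show "g \<in> sharp_lcs \<tau> P Y \<and> restrict g Y = ?h"
      using \<mu> g HBE gh by (auto simp: sharp_lcs_def sharp_at_iff_HBE)
  next
    fix g' assume g': "g' \<in> sharp_lcs \<tau> P Y \<and> restrict g' Y = ?h"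
    then obtain \<nu> where \<nu>: "\<nu> \<in> P" and HBE': "\<And>\<rho>. \<rho> \<in> above P \<nu> \<Longrightarrow> is_HBE \<tau> Y ?h \<rho> g'"
      by (auto simp: sharp_lcs_def sharp_at_iff_HBE)
    obtain \<rho> where "\<rho> \<in> above P \<mu>" "\<rho> \<in> above P \<nu>"
      using directed_family_above[OF assms(1) \<mu> \<nu>] .
    then show "g' = g"
      using unique HBE' by blast
  qed
qed

text \<open>The first component determines the second, and f - g vanishes on Y exactly when g and f
  agree there. Uniqueness of pairs thus becomes uniqueness of sharp extensions.\<close>

lemma sharp_decomposition_iff:
  assumes "f \<in> dual \<tau>"
  shows "p \<in> sharp_lcs \<tau> P Y \<times> annihilator \<tau> Y \<and> f = (\<lambda>x. fst p x + snd p x) \<longleftrightarrow>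
    fst p \<in> sharp_lcs \<tau> P Y \<and> restrict (fst p) Y = restrict f Y \<and> snd p = (\<lambda>x. f x - fst p x)"
    (is "?L \<longleftrightarrow> ?R")
proof
  assume ?L
  then have p: "fst p \<in> sharp_lcs \<tau> P Y" "\<And>y. y \<in> Y \<Longrightarrow> snd p y = 0"
    and sum: "\<And>x. f x = fst p x + snd p x"
    by (auto simp: annihilator_def mem_Times_iff)
  then have "restrict (fst p) Y = restrict f Y"
    by (intro restrict_ext) simp
  with p(1) sum show ?R
    by (simp add: fun_eq_iff)
next
  assume R: ?R
  then have "(\<lambda>x. f x - fst p x) \<in> dual \<tau>"
    using dual_diff[OF assms] sharp_lcs_subset_dual by blast
  moreover have "fst p y = f y" if "y \<in> Y" for y
  proof -
    have "restrict (fst p) Y y = restrict f Y y"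
      using R by simp
    with that show ?thesis
      by simp
  qed
  ultimately show ?L
    using R by (auto simp: annihilator_def mem_Times_iff)
qed

theorem theorem3p6:
  fixes \<tau> :: "'a::real_vector topology"
    and P :: "('a \<Rightarrow> real) set"
    and Y :: "'a set"
  assumes "\<forall>\<rho>\<in>P. seminorm \<rho>"
    and "directed_family P"
    and "\<tau> = seminorm_topology P"
    and "subspace Y"
  shows "(property_SNP \<tau> P Y \<longrightarrow>
            (\<forall>f \<in> dual \<tau>. \<exists>!p. p \<in> sharp_lcs \<tau> P Y \<times> annihilator \<tau> Y \<and>
               f = (\<lambda>x. fst p x + snd p x)))
       \<and> ((\<forall>f \<in> dual \<tau>. \<exists>!p. p \<in> sharp_lcs \<tau> P Y \<times> annihilator \<tau> Y \<and>
               f = (\<lambda>x. fst p x + snd p x)) \<longrightarrow>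
          (\<forall>f1 \<in> sharp_lcs \<tau> P Y. \<forall>f2 \<in> sharp_lcs \<tau> P Y.
             (\<lambda>x. f1 x + f2 x) \<in> annihilator \<tau> Y \<longrightarrow> (\<lambda>x. f1 x + f2 x) = (\<lambda>x. 0)))"
proof (intro conjI impI ballI)
  fix f assume SNP: "property_SNP \<tau> P Y" and f: "f \<in> dual \<tau>"
  obtain g where g: "g \<in> sharp_lcs \<tau> P Y \<and> restrict g Y = restrict f Y"
    and unique: "\<forall>g'. g' \<in> sharp_lcs \<tau> P Y \<and> restrict g' Y = restrict f Y \<longrightarrow> g' = g"
    using property_SNP_unique_sharp[OF assms(2,4) SNP f] by (rule ex1E)
  show "\<exists>!p. p \<in> sharp_lcs \<tau> P Y \<times> annihilator \<tau> Y \<and> f = (\<lambda>x. fst p x + snd p x)"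
    unfolding sharp_decomposition_iff[OF f]
  proof (rule ex1I[of _ "(g, \<lambda>x. f x - g x)"])
    fix p :: "('a \<Rightarrow> real) \<times> ('a \<Rightarrow> real)"
    assume p: "fst p \<in> sharp_lcs \<tau> P Y \<and> restrict (fst p) Y = restrict f Y \<and>
      snd p = (\<lambda>x. f x - fst p x)"
    then have "fst p = g"
      using unique by blast
    with p show "p = (g, \<lambda>x. f x - g x)"
      by (simp add: prod_eq_iff)
  qed (use g in simp)
next
  fix f1 f2
  assume decomp: "\<forall>f \<in> dual \<tau>. \<exists>!p. p \<in> sharp_lcs \<tau> P Y \<times> annihilator \<tau> Y \<and>
      f = (\<lambda>x. fst p x + snd p x)"
    and f1: "f1 \<in> sharp_lcs \<tau> P Y" and f2: "f2 \<in> sharp_lcs \<tau> P Y"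
    and sum: "(\<lambda>x. f1 x + f2 x) \<in> annihilator \<tau> Y"
  \<comment> \<open>Two decompositions of f1: the trivial one, and the one obtained by subtracting
    and adding f2.\<close>
  let ?p = "(f1, \<lambda>x. 0 :: real)" and ?q = "(\<lambda>x. - f2 x, \<lambda>x. f1 x + f2 x)"
  have "f1 \<in> dual \<tau>"
    using f1 sharp_lcs_subset_dual by blast
  with decomp have "\<exists>\<^sub>\<le>\<^sub>1p. p \<in> sharp_lcs \<tau> P Y \<times> annihilator \<tau> Y \<and> f1 = (\<lambda>x. fst p x + snd p x)"
    unfolding ex1_iff_ex_Uniq by blast
  moreover have "?p \<in> sharp_lcs \<tau> P Y \<times> annihilator \<tau> Y \<and> f1 = (\<lambda>x. fst ?p x + snd ?p x)"
    using f1 by (simp add: annihilator_def dual_zero)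
  moreover have "?q \<in> sharp_lcs \<tau> P Y \<times> annihilator \<tau> Y \<and> f1 = (\<lambda>x. fst ?q x + snd ?q x)"
    using sharp_lcs_uminus[OF f2] sum by simp
  ultimately have "?p = ?q"
    by (rule Uniq_D)
  \<comment> \<open>Equality of the second components reads 0 = f1 + f2.\<close>
  then show "(\<lambda>x. f1 x + f2 x) = (\<lambda>x. 0)"
    by (elim Pair_inject) (rule sym)
qed

end
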